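(* Let $\mathbb{A}_1,\mathbb{A}_2\in\mathbb{R}^{n\times n}$ (not necessarily symmetric), let $\mathcal{P}\subset\mathbb{R}^d$ be a compact parameter set, let $\theta_1,\theta_2:\mathcal{P}\to\mathbb{R}$, and let $\mathbb{A}(\mu)=\theta_1(\mu)\mathbb{A}_1+\theta_2(\mu)\mathbb{A}_2$, where the parametric problem $\mathbb{A}(\mu)\mathbf{u}_\mu=\mathbf{f}$, $\mathbf{f}\in\mathbb{R}^n$, is well posed for every $\mu\in\mathcal{P}$ in the sense stated in the context (in particular $\mathbb{A}(\mu)$ is invertible). Let $\mu_0\neq\mu_1\in\mathcal{P}$, $\mathbb{B}=\mathbb{A}(\mu_0)^{-1}$, let $\mathbb{M}\in\mathbb{R}^{n\times n}$ be symmetric positive-definite, let $m>0$ be an integer, let $\kappa(\mu)=\kappa(\mathbb{B}\mathbb{A}(\mu))$ be the condition number of $\mathbb{B}\mathbb{A}(\mu)$ (it does not enter the conclusion), and define \[ \gamma(\mu):=\inf_{\mathbf{v}\neq\mathbf{0}}\frac{(\mathbb{B}\mathbb{A}(\mu)\mathbf{v},\mathbf{v})_{\mathbb{M}}}{(\mathbf{v},\mathbf{v})_{\mathbb{M}}},\qquad \Gamma(\mu):=\sup_{\mathbf{w}\neq\mathbf{0}}\frac{\|\mathbb{B}\mathbb{A}(\mu)\mathbf{w}\|_{\mathbb{M}}}{\|\mathbf{w}\|_{\mathbb{M}}} . \] Assume $\theta_1(\mu_0)\theta_2(\mu_1)-\theta_2(\mu_0)\theta_1(\mu_1)\neq0$.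 Then for any $\mu\in\mathcal{P}$ with $\theta_1(\mu_0)\theta_2(\mu)-\theta_2(\mu_0)\theta_1(\mu)\neq0$, the reduced basis solution $\hat{\mathbf{u}}_\mu$ of the algorithm $\mathrm{RKBM}_1(\mathbb{B},\mathbb{M},\mathcal{P},\mu_0,\mu_1,m)$ satisfies \[ \|\mathbb{B}\mathbb{A}(\mu)(\mathbf{u}_\mu-\hat{\mathbf{u}}_\mu)\|_{\mathbb{M}}\leq\left(1-\frac{\gamma(\mu)^2}{\Gamma(\mu)^2}\right)^{\frac{m}{2}}\|\mathbb{B}\mathbf{f}\|_{\mathbb{M}} . \]
   Context: $(\cdot,\cdot)$ and $\|\cdot\|$ are the Euclidean inner product and norm on $\mathbb{R}^n$; $(\mathbf{v},\mathbf{w})_{\mathbb{M}}:=(\mathbb{M}\mathbf{v},\mathbf{w})$ and $\|\mathbf{v}\|_{\mathbb{M}}:=\sqrt{(\mathbf{v},\mathbf{v})_{\mathbb{M}}}$. Standing setting: $\mathcal{H}$ is an $n$-dimensional Hilbert space with basis $\phi_1,\ldots,\phi_n$ (e.g. a finite element space), $a_1,a_2$ are bilinear forms on $\mathcal{H}$, $a_\mu=\theta_1(\mu)a_1+\theta_2(\mu)a_2$ is not necessarily symmetric or positive-definite, $f\in\mathcal{H}^*$, $\mathbb{A}_j=(a_j(\phi_k,\phi_i))_{1\le i,k\le n}$ and $\mathbf{f}=(f(\phi_1),\ldots,f(\phi_n))^t$. Then $\mathbb{A}(\mu)\mathbf{u}_\mu=\mathbf{f}$ is the matrix form of: find $u_\mu\in\mathcal{H}$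 with $a_\mu(u_\mu,v)=f(v)$ for all $v\in\mathcal{H}$. Well-posedness means that there are constants $c_1,c_2>0$ with \[ \sup_{0\neq v\in\mathcal{H}}\sup_{0\neq w\in\mathcal{H}}\frac{a_\mu(v,w)}{\|v\|_{\mathcal{H}}\|w\|_{\mathcal{H}}}\leq c_1,\qquad \inf_{0\neq v\in\mathcal{H}}\sup_{0\neq w\in\mathcal{H}}\frac{a_\mu(v,w)}{\|v\|_{\mathcal{H}}\|w\|_{\mathcal{H}}}\geq c_2 . \] The algorithm $\mathrm{RKBM}_1(\mathbb{B},\mathbb{M},\mathcal{P},\mu_0,\mu_1,m)$ (Reduced Krylov Basis Method of the first kind) is as follows. Offline stage: use GMRES (the generalized minimum residual method) for $\mathbb{B}\mathbb{A}(\mu_1)\mathbf{u}_{\mu_1}=\mathbb{B}\mathbf{f}$ with initial guess $\mathbf{u}_0=\mathbf{0}$ to generate iterates $\mathbf{u}_1,\ldots,\mathbf{u}_{m-1}$, and set $\mathbf{z}_j=\mathbb{B}(\mathbf{f}-\mathbb{A}(\mu_1)\mathbf{u}_j)$ for $j=0,\ldots,m-1$. Construct the reduced basis subspace $\mathcal{K}_m=\mathrm{Span}\{\mathbf{z}_0,\ldots,\mathbf{z}_{m-1}\}$ and the projection matrix $\mathbb{P}=\left[\mathbf{z}_0/\|\mathbf{z}_0\|,\ldots,\mathbf{z}_{m-1}/\|\mathbf{z}_{m-1}\|\right]$. Online stage: for each $\mu\in\mathcal{P}$, compute the reduced basis solution $\hat{\mathbf{u}}_\mu\in\mathcal{K}_m$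 such that \[ \|\mathbb{B}\mathbf{f}-\mathbb{B}\mathbb{A}(\mu)\hat{\mathbf{u}}_\mu\|_{\mathbb{M}}=\min_{\mathbf{v}\in\mathcal{K}_m}\|\mathbb{B}\mathbf{f}-\mathbb{B}\mathbb{A}(\mu)\mathbf{v}\|_{\mathbb{M}}; \] equivalently, $\hat{\mathbf{u}}_\mu=\mathbb{P}\big((\mathbb{B}\mathbb{A}(\mu)\mathbb{P})^t\mathbb{M}\mathbb{B}\mathbb{A}(\mu)\mathbb{P}\big)^{-1}(\mathbb{B}\mathbb{A}(\mu)\mathbb{P})^t\mathbb{M}\mathbb{B}\mathbf{f}$.
   Formalization: Two assumptions are added, as the bound can fail without either: γ(μ) ≥ 0, and GMRES does not stagnate before convergence (z_{j+1} ≠ z_j whenever z_j ≠ 0, j+1 < m), which follows from linear independence of z_0,…,z_{m-1} as needed by the closed formula for the reduced solution. *)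

theory Defs
  imports "HOL-Analysis.Analysis"
begin

definition inner_wrt :: "real^'n^'n \<Rightarrow> real^'n \<Rightarrow> real^'n \<Rightarrow> real" where
  "inner_wrt M v w = (M *v v) \<bullet> w"

definition norm_wrt :: "real^'n^'n \<Rightarrow> real^'n \<Rightarrow> real" where
  "norm_wrt M v = sqrt (inner_wrt M v v)"

definition sym_pos_def :: "real^'n^'n \<Rightarrow> bool" where
  "sym_pos_def M \<longleftrightarrow> transpose M = M \<and> (\<forall>v. v \<noteq> 0 \<longrightarrow> 0 < (M *v v) \<bullet> v)"

text \<open>A basis indexed by a finite type; its existence makes the ambient space
  of dimension \<open>CARD('n)\<close>, hence complete.\<close>

definition indexed_basis :: "('n::finite \<Rightarrow> 'h::real_vector) \<Rightarrow> bool" where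
  "indexed_basis \<phi> \<longleftrightarrow> inj \<phi> \<and> independent (range \<phi>) \<and> span (range \<phi>) = UNIV"

text \<open>Row index is the test function, column index the trial function.\<close>

definition form_matrix :: "('h \<Rightarrow> 'h \<Rightarrow> real) \<Rightarrow> ('n::finite \<Rightarrow> 'h) \<Rightarrow> real^'n^'n" where
  "form_matrix a \<phi> = (\<chi> i k. a (\<phi> k) (\<phi> i))"

definition load_vector :: "('h \<Rightarrow> real) \<Rightarrow> ('n::finite \<Rightarrow> 'h) \<Rightarrow> real^'n" where
  "load_vector F \<phi> = (\<chi> i. F (\<phi> i))"

text \<open>Suprema and infima are taken in the extended reals, because a real-valued
  supremum of an unbounded set has no meaning.\<close>

definition well_posed :: "('h::real_normed_vector \<Rightarrow> 'h \<Rightarrow> real) \<Rightarrow> bool" where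
  "well_posed a \<longleftrightarrow>
    (\<exists>c\<^sub>1 c\<^sub>2 :: real. 0 < c\<^sub>1 \<and> 0 < c\<^sub>2 \<and>
      (SUP v\<in>-{0}. SUP w\<in>-{0}. ereal (a v w / (norm v * norm w))) \<le> ereal c\<^sub>1 \<and>
      (INF v\<in>-{0}. SUP w\<in>-{0}. ereal (a v w / (norm v * norm w))) \<ge> ereal c\<^sub>2)"

definition param_matrix ::
    "('p \<Rightarrow> real) \<Rightarrow> ('p \<Rightarrow> real) \<Rightarrow> real^'n^'n \<Rightarrow> real^'n^'n \<Rightarrow> 'p \<Rightarrow> real^'n^'n" where
  "param_matrix \<theta>\<^sub>1 \<theta>\<^sub>2 A\<^sub>1 A\<^sub>2 \<mu> = \<theta>\<^sub>1 \<mu> *\<^sub>R A\<^sub>1 + \<theta>\<^sub>2 \<mu> *\<^sub>R A\<^sub>2"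

definition coercivity_const :: "real^'n^'n \<Rightarrow> real^'n^'n \<Rightarrow> real" where
  "coercivity_const M C = (INF v\<in>-{0}. inner_wrt M (C *v v) v / inner_wrt M v v)"

definition opnorm_wrt :: "real^'n^'n \<Rightarrow> real^'n^'n \<Rightarrow> real" where
  "opnorm_wrt M C = (SUP w\<in>-{0}. norm_wrt M (C *v w) / norm_wrt M w)"

definition krylov :: "real^'n^'n \<Rightarrow> real^'n \<Rightarrow> nat \<Rightarrow> (real^'n) set" where
  "krylov C r j = span ((\<lambda>i. (((*v) C) ^^ i) r) ` {..<j})"

text \<open>\<open>u\<close> is the \<open>j\<close>-th GMRES iterate for \<open>C x = b\<close> with initial guess \<open>x\<^sub>0\<close>:
  it minimizes the Euclidean residual norm over \<open>x\<^sub>0 + krylov C (b - C x\<^sub>0) j\<close>.\<close>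

definition gmres_iterate ::
    "real^'n^'n \<Rightarrow> real^'n \<Rightarrow> real^'n \<Rightarrow> nat \<Rightarrow> real^'n \<Rightarrow> bool" where
  "gmres_iterate C b x\<^sub>0 j u \<longleftrightarrow>
    u - x\<^sub>0 \<in> krylov C (b - C *v x\<^sub>0) j \<and>
    (\<forall>v. v - x\<^sub>0 \<in> krylov C (b - C *v x\<^sub>0) j \<longrightarrow> norm (b - C *v u) \<le> norm (b - C *v v))"

text \<open>The offline and online stages of the reduced Krylov basis method. Here \<open>A\<close> is the
  parametric matrix and \<open>z 0, \<dots>, z (m - 1)\<close> are the generators of the reduced space.\<close>

definition rkbm_offline ::
    "('p \<Rightarrow> real^'n^'n) \<Rightarrow> real^'n \<Rightarrow> real^'n^'n \<Rightarrow> 'p \<Rightarrow> nat \<Rightarrow> (nat \<Rightarrow> real^'n) \<Rightarrow> bool" where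
  "rkbm_offline A f B \<mu>\<^sub>1 m z \<longleftrightarrow>
    (\<exists>u. \<forall>j<m. gmres_iterate (B ** A \<mu>\<^sub>1) (B *v f) 0 j (u j) \<and>
               z j = B *v (f - A \<mu>\<^sub>1 *v u j))"

definition reduced_space :: "nat \<Rightarrow> (nat \<Rightarrow> real^'n) \<Rightarrow> (real^'n) set" where
  "reduced_space m z = span (z ` {..<m})"

definition rkbm_online ::
    "('p \<Rightarrow> real^'n^'n) \<Rightarrow> real^'n \<Rightarrow> real^'n^'n \<Rightarrow> real^'n^'n \<Rightarrow> nat \<Rightarrow> (nat \<Rightarrow> real^'n) \<Rightarrow>
     'p \<Rightarrow> real^'n \<Rightarrow> bool" where
  "rkbm_online A f B M m z \<mu> u \<longleftrightarrow>
    u \<in> reduced_space m z \<and>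
    (\<forall>v\<in>reduced_space m z.
      norm_wrt M (B *v f - (B ** A \<mu>) *v u) \<le> norm_wrt M (B *v f - (B ** A \<mu>) *v v))"

text \<open>The GMRES residuals never repeat before the exact solution is reached. This is implied
  by linear independence of \<open>z 0, \<dots>, z (m - 1)\<close>, i.e. by invertibility of the reduced
  normal-equation matrix \<open>(B A(\<mu>) P)\<^sup>t M (B A(\<mu>) P)\<close>. When GMRES stagnates, the span of
  the residuals can be smaller than the Krylov space.\<close>

definition no_stagnation :: "nat \<Rightarrow> (nat \<Rightarrow> real^'n) \<Rightarrow> bool" where
  "no_stagnation m z \<longleftrightarrow> (\<forall>j. Suc j < m \<longrightarrow> z j \<noteq> 0 \<longrightarrow> z (Suc j) \<noteq> z j)"

end

theory Submission
  imports Defs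
begin

text \<open>Well-posedness makes \<open>A \<mu>\<^sub>0\<close> invertible, and the determinant condition puts \<open>A \<mu>\<close> in the span
  of \<open>A \<mu>\<^sub>0\<close> and \<open>A \<mu>\<^sub>1\<close>; hence \<open>C = B A \<mu>\<close> has the form \<open>s I + t B A \<mu>\<^sub>1\<close>. As long as GMRES does not
  stagnate, its residuals span the Krylov space of \<open>B A \<mu>\<^sub>1\<close>, which therefore contains some \<open>v\<close> with
  \<open>(I - \<alpha> C)\<^sup>m B f = B f - C v\<close>. The choice \<open>\<alpha> = \<gamma> / \<Gamma>\<^sup>2\<close> makes every factor \<open>I - \<alpha> C\<close>
  contract the squared \<open>M\<close>-norm by \<open>1 - \<gamma>\<^sup>2 / \<Gamma>\<^sup>2\<close>, and the minimal residual is no larger.\<close>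

section \<open>Krylov spaces and GMRES residuals\<close>

lemma krylov_0 [simp]: "krylov C r 0 = {0}"
  by (simp add: krylov_def)

lemma subspace_krylov: "subspace (krylov C r j)"
  by (simp add: krylov_def)

lemma krylov_mono: "i \<le> j \<Longrightarrow> krylov C r i \<subseteq> krylov C r j"
  unfolding krylov_def by (intro span_mono image_mono) auto

lemma krylov_power_mem: "i < j \<Longrightarrow> (((*v) C) ^^ i) r \<in> krylov C r j"
  unfolding krylov_def by (intro span_base) auto

lemma krylov_Suc: "krylov C r (Suc j) = span (insert ((((*v) C) ^^ j) r) (krylov C r j))"
proof -
  have "krylov C r (Suc j) = span (insert ((((*v) C) ^^ j) r) ((\<lambda>i. (((*v) C) ^^ i) r) ` {..<j}))"
    by (simp add: krylov_def lessThan_Suc)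
  then show ?thesis
    by (simp add: krylov_def span_insert span_span)
qed

lemma krylov_Suc_decomp:
  assumes "v \<in> krylov C r (Suc j)"
  obtains c w where "w \<in> krylov C r j" "v = w + c *\<^sub>R (((*v) C) ^^ j) r"
proof -
  have [simp]: "span (krylov C r j) = krylov C r j"
    unfolding krylov_def by (rule span_span)
  obtain c where "v - c *\<^sub>R (((*v) C) ^^ j) r \<in> krylov C r j"
    using assms unfolding krylov_Suc span_insert by auto
  then show ?thesis
    by (rule that[where c = c]) simp
qed

lemma krylov_mult_mem:
  assumes "v \<in> krylov C r j"
  shows "C *v v \<in> krylov C r (Suc j)"
proof -
  have "(*v) C ` krylov C r j = span ((*v) C ` (\<lambda>i. (((*v) C) ^^ i) r) ` {..<j})"
    unfolding krylov_def using linear_span_image[OF matrix_vector_mul_linear] by metis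
  also have "\<dots> \<subseteq> krylov C r (Suc j)"
  proof -
    have "(*v) C ` (\<lambda>i. (((*v) C) ^^ i) r) ` {..<j} \<subseteq> (\<lambda>i. (((*v) C) ^^ i) r) ` {..<Suc j}"
    proof (clarify)
      fix i assume "i < j"
      then show "C *v (((*v) C) ^^ i) r \<in> (\<lambda>i. (((*v) C) ^^ i) r) ` {..<Suc j}"
        by (intro image_eqI[where x = "Suc i"]) auto
    qed
    then show ?thesis
      unfolding krylov_def by (rule span_mono)
  qed
  finally show ?thesis using assms by blast
qed

text \<open>Applying \<open>C\<close> to a relation among the powers gives one for the next power,
  so linear dependence persists at every later index.\<close>

lemma krylov_stable:
  assumes "(((*v) C) ^^ k) r \<in> krylov C r k" "k \<le> j"
  shows "(((*v) C) ^^ j) r \<in> krylov C r j"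
  using assms(2)
proof (induction j rule: dec_induct)
  case base
  show ?case by (fact assms(1))
next
  case (step j)
  show ?case using krylov_mult_mem[OF step.IH] by simp
qed

text \<open>Induction on \<open>j\<close>, splitting off the top power in \<open>v\<close>. If its
  coefficient vanishes, the solution lies in the smaller space; otherwise the equation
  \<open>C *v v = r\<close> can be solved for the next power. A zero residual thus means that the
  Krylov spaces have stopped growing.\<close>

lemma krylov_stable_if_solution:
  assumes "v \<in> krylov C r j" "C *v v = r"
  shows "(((*v) C) ^^ j) r \<in> krylov C r j"
  using assms(1)
proof (induction j)
  case 0
  then show ?case using assms(2) by simp
next
  case (Suc j)
  obtain c w where w: "w \<in> krylov C r j" and v: "v = w + c *\<^sub>R (((*v) C) ^^ j) r"
    using krylov_Suc_decomp[OF Suc.prems] .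
  show ?case
  proof (cases "c = 0")
    case True
    then have "(((*v) C) ^^ j) r \<in> krylov C r j" using Suc.IH v w by simp
    then show ?thesis by (rule krylov_stable) simp
  next
    case False
    have "r = C *v w + c *\<^sub>R (((*v) C) ^^ Suc j) r"
      using assms(2) v by (simp add: matrix_vector_right_distrib matrix_vector_mult_scaleR)
    then have eq: "c *\<^sub>R (((*v) C) ^^ Suc j) r = r - C *v w"
      by (simp add: algebra_simps)
    have "(((*v) C) ^^ Suc j) r = (1 / c) *\<^sub>R (r - C *v w)"
      unfolding eq[symmetric] using False by simp
    moreover have "r \<in> krylov C r (Suc j)"
      using krylov_power_mem[of 0 "Suc j" C r] by simp
    ultimately show ?thesis
      using krylov_mult_mem[OF w] by (simp add: subspace_krylov subspace_diff subspace_scale)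
  qed
qed

text \<open>Strict convexity from the parallelogram law: distinct vectors of equal norm have a
  strictly shorter midpoint.\<close>

lemma eq_if_norm_le_midpoint:
  fixes a b :: "'a::real_inner"
  assumes "norm a = norm b" "norm a \<le> norm ((1/2) *\<^sub>R (a + b))"
  shows "a = b"
proof -
  have "(norm (a - b))\<^sup>2 = 2 * (norm a)\<^sup>2 + 2 * (norm b)\<^sup>2 - (norm (a + b))\<^sup>2"
    by (simp add: power2_norm_eq_inner inner_simps inner_commute)
  moreover have "(2 * norm a)\<^sup>2 \<le> (norm (a + b))\<^sup>2"
    using assms(2) by (intro power_mono) auto
  ultimately have "(norm (a - b))\<^sup>2 \<le> 0"
    using assms(1) by (simp add: power_mult_distrib)
  then show ?thesis by simp
qed

text \<open>\<open>C\<close> may be singular, so minimizers can differ while their residuals agree.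
  Each iterate competes with the other, which gives equal norms; the midpoint of the residuals is
  the residual of an admissible vector, so strict convexity applies.\<close>

lemma gmres_residual_unique:
  assumes "gmres_iterate C b 0 i u" "gmres_iterate C b 0 j v" "i \<le> j" "v \<in> krylov C b i"
  shows "b - C *v u = b - C *v v"
proof (rule eq_if_norm_le_midpoint)
  have u: "u \<in> krylov C b i"
    and umin: "\<And>w. w \<in> krylov C b i \<Longrightarrow> norm (b - C *v u) \<le> norm (b - C *v w)"
    using assms(1) by (auto simp: gmres_iterate_def)
  have vmin: "\<And>w. w \<in> krylov C b j \<Longrightarrow> norm (b - C *v v) \<le> norm (b - C *v w)"
    using assms(2) by (auto simp: gmres_iterate_def)
  show "norm (b - C *v u) = norm (b - C *v v)"
    using umin[OF assms(4)] vmin u krylov_mono[OF assms(3), of C b] by (meson antisym subsetD)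
  have "(1/2) *\<^sub>R (u + v) \<in> krylov C b i"
    using u assms(4) by (simp add: subspace_krylov subspace_add subspace_scale)
  moreover have "b - C *v ((1/2) *\<^sub>R (u + v)) = (1/2) *\<^sub>R ((b - C *v u) + (b - C *v v))"
    by (simp add: matrix_vector_mult_scaleR matrix_vector_right_distrib)
      (simp add: vec_eq_iff field_simps)
  ultimately show "norm (b - C *v u) \<le> norm ((1/2) *\<^sub>R ((b - C *v u) + (b - C *v v)))"
    using umin by metis
qed

lemma gmres_residual_mem_krylov:
  assumes "gmres_iterate C b 0 j u"
  shows "b - C *v u \<in> krylov C b (Suc j)"
  using assms krylov_mult_mem[of u C b j] krylov_power_mem[of 0 "Suc j" C b]
  by (simp add: gmres_iterate_def subspace_krylov subspace_diff)

text \<open>Induction on \<open>j\<close>: the new residual replaces the new power as a generator.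
  One inclusion is \<open>gmres_residual_mem_krylov\<close>. For the other, the new power must occur
  in \<open>z j\<close> with nonzero coefficient, and this is where stagnation has to be
  excluded.\<close>

lemma span_gmres_residuals:
  assumes gmres: "\<And>j. j < m \<Longrightarrow> gmres_iterate C b 0 j (u j)"
    and z: "\<And>j. j < m \<Longrightarrow> z j = b - C *v u j"
    and ns: "no_stagnation m z"
    and "j \<le> m"
  shows "span (z ` {..<j}) = krylov C b j"
  using \<open>j \<le> m\<close>
proof (induction j)
  case 0
  then show ?case by simp
next
  case (Suc j)
  let ?p = "(((*v) C) ^^ j) b" and ?K = "krylov C b"
  have IH: "span (z ` {..<j}) = ?K j" and jm: "j < m" using Suc by auto
  have "span (z ` {..<Suc j}) = span (insert (z j) (?K j))"
    by (simp add: lessThan_Suc span_insert span_span flip: IH)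
  also have "\<dots> = span (insert ?p (?K j))"
  proof (rule span_eq[THEN iffD2], intro conjI)
    have "z j \<in> span (insert ?p (?K j))"
      using gmres_residual_mem_krylov[OF gmres[OF jm]] z[OF jm] by (simp add: krylov_Suc)
    then show "insert (z j) (?K j) \<subseteq> span (insert ?p (?K j))"
      by (auto intro: span_base)
    have "?p \<in> span (insert (z j) (?K j))"
    proof (cases "?p \<in> ?K j")
      case True
      then show ?thesis by (intro span_base) simp
    next
      case new: False
      show ?thesis
      \<comment> \<open>At index 0 the iterate is 0 and the residual is \<open>b\<close> itself.
        Later, \<open>?p\<close> enters the residual only through the top power of
        \<open>u j\<close>, one multiplication by \<open>C\<close> below it.\<close>
      proof (cases j)
        case 0
        then have "u j = 0" using gmres[OF jm] by (simp add: gmres_iterate_def)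
        then show ?thesis using z[OF jm] 0 by (simp add: span_base)
      next
        case (Suc i)
        have uj: "u j \<in> ?K (Suc i)"
          using gmres[OF jm] Suc by (simp add: gmres_iterate_def)
        obtain c w where w: "w \<in> ?K i" and uw: "u j = w + c *\<^sub>R (((*v) C) ^^ i) b"
          using krylov_Suc_decomp[OF uj] .
        \<comment> \<open>With \<open>c = 0\<close> the iterate lies in the previous space, so the
          residual repeats. By \<open>no_stagnation\<close> it is then zero, the Krylov space has
          stopped growing, and \<open>?p\<close> is not new.\<close>
        have "c \<noteq> 0"
        proof
          assume "c = 0"
          then have "u j \<in> ?K i" using uw w by simp
          then have "z i = z j"
            using gmres_residual_unique[OF gmres gmres] z Suc jm by simp
          then have "z i = 0" using ns Suc jm by (auto simp: no_stagnation_def)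
          then have "C *v u i = b" "u i \<in> ?K i"
            using z[of i] gmres[of i] Suc jm by (auto simp: gmres_iterate_def)
          then have "(((*v) C) ^^ i) b \<in> ?K i" by (intro krylov_stable_if_solution)
          then have "?p \<in> ?K j" by (rule krylov_stable) (simp add: Suc)
          then show False using new by simp
        qed
        have "z j = b - C *v w - c *\<^sub>R ?p"
          using z[OF jm] uw Suc by (simp add: matrix_vector_right_distrib matrix_vector_mult_scaleR)
        then have eq: "c *\<^sub>R ?p = b - C *v w - z j"
          by (simp add: algebra_simps)
        have "?p = (1 / c) *\<^sub>R (b - C *v w - z j)"
          unfolding eq[symmetric] using \<open>c \<noteq> 0\<close> by simp
        moreover have "C *v w \<in> ?K j" "b \<in> ?K j"
          using krylov_mult_mem[OF w] krylov_power_mem[of 0 j C b] Suc by auto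
        ultimately show ?thesis
          by (simp add: span_base span_diff span_scale)
      qed
    qed
    then show "insert ?p (?K j) \<subseteq> span (insert (z j) (?K j))"
      by (auto intro: span_base)
  qed
  finally show ?case by (simp add: krylov_Suc)
qed

text \<open>The vector \<open>v\<close> is the \<open>j\<close>-th Richardson iterate for
  \<open>C\<close> from initial guess 0, and the left-hand side is its residual. Since
  \<open>C\<close> is a polynomial in \<open>D\<close> of degree at most one, each step needs only
  one further power of \<open>D\<close>.\<close>

lemma krylov_richardson:
  assumes C: "\<And>v. C *v v = s *\<^sub>R v + t *\<^sub>R (D *v v)"
  shows "\<exists>v \<in> krylov D r j. ((\<lambda>x. x - \<alpha> *\<^sub>R (C *v x)) ^^ j) r = r - C *v v"
proof (induction j)
  case 0
  then show ?case by simp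
next
  case (Suc j)
  then obtain v where v: "v \<in> krylov D r j"
    and eq: "((\<lambda>x. x - \<alpha> *\<^sub>R (C *v x)) ^^ j) r = r - C *v v" by blast
  have K: "r \<in> krylov D r (Suc j)" "v \<in> krylov D r (Suc j)" "D *v v \<in> krylov D r (Suc j)"
    using krylov_power_mem[of 0 "Suc j" D r] krylov_mono[of j "Suc j" D r] v krylov_mult_mem[OF v]
    by auto
  have "C *v v \<in> krylov D r (Suc j)"
    unfolding C using K by (intro subspace_add subspace_scale subspace_krylov)
  then have "v + \<alpha> *\<^sub>R (r - C *v v) \<in> krylov D r (Suc j)"
    using K by (intro subspace_add subspace_scale subspace_diff subspace_krylov)
  \<comment> \<open>The Richardson update of \<open>v\<close> multiplies its residual by
    \<open>I - \<alpha> C\<close>.\<close>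
  moreover have "((\<lambda>x. x - \<alpha> *\<^sub>R (C *v x)) ^^ Suc j) r = r - C *v (v + \<alpha> *\<^sub>R (r - C *v v))"
    by (simp add: eq matrix_vector_right_distrib matrix_vector_mult_scaleR)
  ultimately show ?case by blast
qed

section \<open>Contraction in the weighted norm\<close>

lemma inner_wrt_commute:
  assumes "sym_pos_def M"
  shows "inner_wrt M v w = inner_wrt M w v"
proof -
  have "M *v v = v v* M"
    using assms transpose_matrix_vector[of M v] by (simp add: sym_pos_def_def)
  then show ?thesis
    unfolding inner_wrt_def by (metis dot_lmul_matrix inner_commute)
qed

lemma inner_wrt_pos: "sym_pos_def M \<Longrightarrow> v \<noteq> 0 \<Longrightarrow> 0 < inner_wrt M v v"
  by (simp add: inner_wrt_def sym_pos_def_def)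

lemma inner_wrt_nonneg: "sym_pos_def M \<Longrightarrow> 0 \<le> inner_wrt M v v"
  by (cases "v = 0") (auto simp: inner_wrt_def sym_pos_def_def less_imp_le)

lemma norm_wrt_square: "sym_pos_def M \<Longrightarrow> (norm_wrt M v)\<^sup>2 = inner_wrt M v v"
  by (simp add: norm_wrt_def inner_wrt_nonneg)

lemma norm_wrt_nonneg: "sym_pos_def M \<Longrightarrow> 0 \<le> norm_wrt M v"
  by (simp add: norm_wrt_def inner_wrt_nonneg)

text \<open>The constant is the minimum of the quadratic form on the compact unit sphere;
  homogeneity extends the bound to all vectors.\<close>

lemma inner_wrt_coercive:
  fixes M :: "real^'n^'n"
  assumes "sym_pos_def M"
  obtains c where "0 < c" "\<And>v. c * (norm v)\<^sup>2 \<le> inner_wrt M v v"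
proof -
  have "continuous_on (sphere 0 1) (\<lambda>v. inner_wrt M v v)"
    unfolding inner_wrt_def by (intro continuous_intros linear_continuous_on matrix_vector_mul_bounded_linear)
  moreover have "sphere (0::real^'n) 1 \<noteq> {}" by simp
  ultimately obtain x where x: "x \<in> sphere 0 1"
    and min: "\<And>y. y \<in> sphere 0 1 \<Longrightarrow> inner_wrt M x x \<le> inner_wrt M y y"
    using continuous_attains_inf[OF compact_sphere, of "0::real^'n" 1 "\<lambda>v. inner_wrt M v v"] by blast
  show ?thesis
  proof (rule that[of "inner_wrt M x x"])
    show "0 < inner_wrt M x x" using x assms by (intro inner_wrt_pos) auto
    fix v
    show "inner_wrt M x x * (norm v)\<^sup>2 \<le> inner_wrt M v v"
    proof (cases "v = 0")
      case True
      then show ?thesis by (simp add: inner_wrt_def)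
    next
      case False
      then have "inner_wrt M x x \<le> inner_wrt M ((1 / norm v) *\<^sub>R v) ((1 / norm v) *\<^sub>R v)"
        by (intro min) simp
      also have "\<dots> = inner_wrt M v v / (norm v)\<^sup>2"
        by (simp add: inner_wrt_def matrix_vector_mult_scaleR power2_eq_square)
      finally show ?thesis using False by (simp add: field_simps)
    qed
  qed
qed

lemma inner_wrt_le_norm_mult: "\<bar>inner_wrt M v w\<bar> \<le> onorm ((*v) M) * (norm v * norm w)"
proof -
  have "\<bar>inner_wrt M v w\<bar> \<le> norm (M *v v) * norm w"
    unfolding inner_wrt_def by (rule Cauchy_Schwarz_ineq2)
  also have "\<dots> \<le> onorm ((*v) M) * norm v * norm w"
    by (intro mult_right_mono onorm matrix_vector_mul_bounded_linear norm_ge_zero)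
  finally show ?thesis by (simp add: mult.assoc)
qed

text \<open>A real-valued \<open>INF\<close> is known to be a lower bound only once the set is
  bounded below, so most of the proof bounds the quotients.\<close>

lemma coercivity_const_bound:
  fixes M C :: "real^'n^'n"
  assumes M: "sym_pos_def M"
  shows "coercivity_const M C * inner_wrt M v v \<le> inner_wrt M (C *v v) v"
proof (cases "v = 0")
  case True
  then show ?thesis by (simp add: inner_wrt_def)
next
  case False
  obtain c where c: "0 < c" and low: "\<And>v. c * (norm v)\<^sup>2 \<le> inner_wrt M v v"
    using inner_wrt_coercive[OF M] by blast
  \<comment> \<open>The numerator is at most \<open>k\<close> times the squared Euclidean norm in
    absolute value, and the denominator is at least \<open>c\<close> times it.\<close>
  define k where "k = onorm ((*v) M) * onorm ((*v) C)"
  have pos: "0 \<le> k"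
    unfolding k_def by (intro mult_nonneg_nonneg onorm_pos_le matrix_vector_mul_bounded_linear)
  have "- (k / c) \<le> inner_wrt M (C *v w) w / inner_wrt M w w" if "w \<noteq> 0" for w
  proof -
    have "\<bar>inner_wrt M (C *v w) w\<bar> \<le> onorm ((*v) M) * (norm (C *v w) * norm w)"
      by (rule inner_wrt_le_norm_mult)
    also have "\<dots> \<le> onorm ((*v) M) * (onorm ((*v) C) * norm w * norm w)"
      by (intro mult_left_mono mult_right_mono onorm onorm_pos_le matrix_vector_mul_bounded_linear) auto
    also have "\<dots> = (k / c) * (c * (norm w)\<^sup>2)"
      using c by (simp add: k_def power2_eq_square)
    also have "\<dots> \<le> (k / c) * inner_wrt M w w"
      using low pos c by (intro mult_left_mono) auto
    finally show ?thesis
      using inner_wrt_pos[OF M that] by (simp add: pos_le_divide_eq)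
  qed
  then have "bdd_below ((\<lambda>w. inner_wrt M (C *v w) w / inner_wrt M w w) ` (- {0}))"
    by (intro bdd_belowI2[where m = "- (k / c)"]) auto
  then have "coercivity_const M C \<le> inner_wrt M (C *v v) v / inner_wrt M v v"
    unfolding coercivity_const_def using False by (intro cINF_lower) auto
  then show ?thesis
    using inner_wrt_pos[OF M False] by (simp add: pos_le_divide_eq)
qed

text \<open>As for the coercivity constant, the real-valued \<open>SUP\<close> first requires a
  bound on the quotients, here \<open>sqrt (k / c)\<close>.\<close>

lemma opnorm_wrt_bound:
  fixes M C :: "real^'n^'n"
  assumes M: "sym_pos_def M"
  shows "norm_wrt M (C *v v) \<le> opnorm_wrt M C * norm_wrt M v"
proof (cases "v = 0")
  case True
  then show ?thesis by (simp add: inner_wrt_def norm_wrt_def)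
next
  case False
  obtain c where c: "0 < c" and low: "\<And>v. c * (norm v)\<^sup>2 \<le> inner_wrt M v v"
    using inner_wrt_coercive[OF M] by blast
  define k where "k = onorm ((*v) M) * (onorm ((*v) C))\<^sup>2"
  have pos: "0 \<le> k"
    unfolding k_def by (intro mult_nonneg_nonneg onorm_pos_le matrix_vector_mul_bounded_linear) simp
  have npos: "0 < norm_wrt M w" if "w \<noteq> 0" for w
    using inner_wrt_pos[OF M that] by (simp add: norm_wrt_def)
  have "norm_wrt M (C *v w) / norm_wrt M w \<le> sqrt (k / c)" if "w \<noteq> 0" for w
  proof -
    have "inner_wrt M (C *v w) (C *v w) \<le> onorm ((*v) M) * (norm (C *v w) * norm (C *v w))"
      using inner_wrt_le_norm_mult[of M "C *v w" "C *v w"] by linarith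
    also have "\<dots> \<le> onorm ((*v) M) * ((onorm ((*v) C) * norm w) * (onorm ((*v) C) * norm w))"
      by (intro mult_left_mono mult_mono onorm onorm_pos_le matrix_vector_mul_bounded_linear
          mult_nonneg_nonneg) auto
    also have "\<dots> = (k / c) * (c * (norm w)\<^sup>2)"
      using c by (simp add: k_def power2_eq_square)
    also have "\<dots> \<le> (k / c) * inner_wrt M w w"
      using low pos c by (intro mult_left_mono) auto
    finally have "norm_wrt M (C *v w) \<le> sqrt (k / c) * norm_wrt M w"
      by (simp add: norm_wrt_def flip: real_sqrt_mult)
    then show ?thesis
      using npos[OF that] by (simp add: pos_divide_le_eq)
  qed
  then have "bdd_above ((\<lambda>w. norm_wrt M (C *v w) / norm_wrt M w) ` (- {0}))"
    by (intro bdd_aboveI2[where M = "sqrt (k / c)"]) auto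
  then have "norm_wrt M (C *v v) / norm_wrt M v \<le> opnorm_wrt M C"
    unfolding opnorm_wrt_def using False by (intro cSUP_upper) auto
  then show ?thesis
    using npos[OF False] by (simp add: pos_divide_le_eq)
qed

text \<open>Expanding the square bounds it by \<open>1 - 2 * \<alpha> * \<gamma> + \<alpha>\<^sup>2
  * \<Gamma>\<^sup>2\<close> times \<open>inner_wrt M v v\<close>. For nonzero \<Gamma> the step
  length \<open>\<gamma> / \<Gamma>\<^sup>2\<close> minimizes this quadratic in \<alpha>.\<close>

lemma richardson_step_contraction:
  fixes M C :: "real^'n^'n"
  assumes M: "sym_pos_def M" and "0 \<le> coercivity_const M C"
  defines "\<gamma> \<equiv> coercivity_const M C" and "\<Gamma> \<equiv> opnorm_wrt M C"
  shows "inner_wrt M (v - (\<gamma> / \<Gamma>\<^sup>2) *\<^sub>R (C *v v)) (v - (\<gamma> / \<Gamma>\<^sup>2) *\<^sub>R (C *v v))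
    \<le> (1 - \<gamma>\<^sup>2 / \<Gamma>\<^sup>2) * inner_wrt M v v"
proof -
  define \<alpha> where "\<alpha> = \<gamma> / \<Gamma>\<^sup>2"
  have \<alpha>: "0 \<le> \<alpha>" using assms by (simp add: \<alpha>_def)
  have "(norm_wrt M (C *v v))\<^sup>2 \<le> (\<Gamma> * norm_wrt M v)\<^sup>2"
    unfolding \<Gamma>_def by (intro power_mono opnorm_wrt_bound norm_wrt_nonneg M)
  then have up: "inner_wrt M (C *v v) (C *v v) \<le> \<Gamma>\<^sup>2 * inner_wrt M v v"
    by (simp add: norm_wrt_square[OF M] power_mult_distrib)
  have "inner_wrt M (v - \<alpha> *\<^sub>R (C *v v)) (v - \<alpha> *\<^sub>R (C *v v))
    = inner_wrt M v v - \<alpha> * inner_wrt M (C *v v) v - \<alpha> * inner_wrt M v (C *v v)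
      + \<alpha>\<^sup>2 * inner_wrt M (C *v v) (C *v v)"
    by (simp add: inner_wrt_def matrix_vector_mult_diff_distrib matrix_vector_mult_scaleR
        inner_simps power2_eq_square algebra_simps)
  also have "\<dots> = inner_wrt M v v - 2 * \<alpha> * inner_wrt M (C *v v) v
      + \<alpha>\<^sup>2 * inner_wrt M (C *v v) (C *v v)"
    using inner_wrt_commute[OF M, of v "C *v v"] by simp
  \<comment> \<open>Nonnegativity of \<alpha> lets the coercivity bound enter the cross term with
    the right sign.\<close>
  also have "\<dots> \<le> inner_wrt M v v - 2 * \<alpha> * (\<gamma> * inner_wrt M v v) + \<alpha>\<^sup>2 * (\<Gamma>\<^sup>2 * inner_wrt M v v)"
    using \<alpha> up coercivity_const_bound[OF M, of C v]
    by (intro add_mono diff_mono mult_left_mono) (auto simp: \<gamma>_def)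
  also have "\<dots> = (1 - \<gamma>\<^sup>2 / \<Gamma>\<^sup>2) * inner_wrt M v v"
    \<comment> \<open>For zero \<Gamma>, division by zero makes both \<alpha> and the quotient 0,
      and the two sides agree.\<close>
    by (cases "\<Gamma> = 0") (simp_all add: \<alpha>_def power2_eq_square field_simps)
  finally show ?thesis by (simp add: \<alpha>_def)
qed

text \<open>For one nonzero vector, the factor times a positive number bounds a nonnegative squared
  norm; \<gamma> and \<Gamma> need not be compared directly.\<close>

lemma contraction_factor_nonneg:
  fixes M C :: "real^'n^'n"
  assumes M: "sym_pos_def M" and "0 \<le> coercivity_const M C"
  shows "0 \<le> 1 - (coercivity_const M C)\<^sup>2 / (opnorm_wrt M C)\<^sup>2"
proof -
  obtain v :: "real^'n" where "v \<noteq> 0" using UNIV_not_singleton[of "0::real^'n"] by blast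
  then show ?thesis
    using richardson_step_contraction[OF assms, of v] inner_wrt_pos[OF M, of v]
      inner_wrt_nonneg[OF M]
    by (meson order_trans zero_le_mult_iff not_less)
qed

lemma richardson_contraction:
  fixes M C :: "real^'n^'n"
  assumes M: "sym_pos_def M" and \<gamma>: "0 \<le> coercivity_const M C" and "0 < m"
  defines "\<gamma> \<equiv> coercivity_const M C" and "\<Gamma> \<equiv> opnorm_wrt M C"
  shows "norm_wrt M (((\<lambda>x. x - (\<gamma> / \<Gamma>\<^sup>2) *\<^sub>R (C *v x)) ^^ m) r)
    \<le> (1 - \<gamma>\<^sup>2 / \<Gamma>\<^sup>2) powr (real m / 2) * norm_wrt M r"
proof -
  define q where "q = 1 - \<gamma>\<^sup>2 / \<Gamma>\<^sup>2"
  have q: "0 \<le> q"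
    unfolding q_def \<gamma>_def \<Gamma>_def by (rule contraction_factor_nonneg[OF M \<gamma>])
  have "norm_wrt M (((\<lambda>x. x - (\<gamma> / \<Gamma>\<^sup>2) *\<^sub>R (C *v x)) ^^ k) r) \<le> sqrt q ^ k * norm_wrt M r" for k
  proof (induction k)
    case 0
    then show ?case by simp
  next
    case (Suc k)
    let ?x = "((\<lambda>x. x - (\<gamma> / \<Gamma>\<^sup>2) *\<^sub>R (C *v x)) ^^ k) r"
    have "norm_wrt M (?x - (\<gamma> / \<Gamma>\<^sup>2) *\<^sub>R (C *v ?x)) \<le> sqrt q * norm_wrt M ?x"
      using richardson_step_contraction[OF M \<gamma>, of ?x]
      unfolding q_def \<gamma>_def \<Gamma>_def norm_wrt_def real_sqrt_mult[symmetric]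
      by (rule real_sqrt_le_mono)
    also have "\<dots> \<le> sqrt q * (sqrt q ^ k * norm_wrt M r)"
      using Suc.IH q by (intro mult_left_mono) auto
    finally show ?case by (simp add: mult.assoc)
  qed
  \<comment> \<open>At \<open>q = 0\<close> the \<open>powr\<close> side is 0, which matches the
    power only because \<open>m\<close> is positive.\<close>
  moreover have "sqrt q ^ m = q powr (real m / 2)"
  proof (cases "q = 0")
    case True
    then show ?thesis using \<open>0 < m\<close> by simp
  next
    case False
    then show ?thesis
      using q by (simp add: powr_half_sqrt[symmetric] powr_powr flip: powr_realpow)
  qed
  ultimately show ?thesis unfolding q_def by metis
qed

section \<open>Invertibility of the parametric matrix\<close>

text \<open>A nonzero \<open>v\<close> annihilating all test functions would have inner supremum at
  most 0, against the positive inf-sup constant.\<close>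

lemma well_posed_nondegenerate:
  assumes "well_posed a" "\<And>w. a v w = 0"
  shows "v = 0"
proof (rule ccontr)
  assume v: "v \<noteq> 0"
  obtain c where c: "0 < c"
    and inf: "ereal c \<le> (INF v\<in>-{0}. SUP w\<in>-{0}. ereal (a v w / (norm v * norm w)))"
    using assms(1) unfolding well_posed_def by auto
  have "(INF v\<in>-{0}. SUP w\<in>-{0}. ereal (a v w / (norm v * norm w)))
      \<le> (SUP w\<in>-{0}. ereal (a v w / (norm v * norm w)))"
    using v by (intro INF_lower) auto
  also have "\<dots> \<le> 0"
    using assms(2) by (intro SUP_least) simp
  finally have "ereal c \<le> 0" using inf by (rule order_trans[rotated])
  then show False using c by simp
qed

lemma form_matrix_mult_nth:
  assumes "bilinear a"
  shows "(form_matrix a \<phi> *v x) $ i = a (\<Sum>k\<in>UNIV. x $ k *\<^sub>R \<phi> k) (\<phi> i)"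
proof -
  have lin: "linear (\<lambda>v. a v (\<phi> i))" using assms by (simp add: bilinear_def)
  show ?thesis
    by (simp add: form_matrix_def matrix_vector_mult_def linear_sum[OF lin] linear_cmul[OF lin]
        mult.commute)
qed

text \<open>A kernel vector holds the coordinates of some \<open>v\<close> with \<open>a v\<close>
  zero on the basis, hence everywhere. Nondegeneracy gives \<open>v = 0\<close> and independence
  gives zero coordinates; a square matrix with trivial kernel is invertible.\<close>

lemma invertible_form_matrix:
  fixes \<phi> :: "'n::finite \<Rightarrow> 'h::real_normed_vector"
  assumes basis: "indexed_basis \<phi>" and a: "bilinear a" and wp: "well_posed a"
  shows "invertible (form_matrix a \<phi>)"
proof -
  have "x = 0" if x: "form_matrix a \<phi> *v x = 0" for x
  proof -
    define v where "v = (\<Sum>k\<in>UNIV. x $ k *\<^sub>R \<phi> k)"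
    have lin: "linear (a v)" using a by (simp add: bilinear_def)
    have "a v (\<phi> i) = 0" for i
      using form_matrix_mult_nth[OF a, of \<phi> x i] x by (simp add: v_def)
    then have "a v w = 0" for w
      using basis linear_eq_0_on_span[OF lin, of "range \<phi>" w] by (auto simp: indexed_basis_def)
    then have "v = 0" by (rule well_posed_nondegenerate[OF wp])
    \<comment> \<open>Independence is a property of the set \<open>range \<phi>\<close>, so the
      indexed sum is rewritten over that set through injectivity.\<close>
    moreover have "v = (\<Sum>b\<in>range \<phi>. x $ (inv \<phi> b) *\<^sub>R b)"
      using basis by (simp add: v_def indexed_basis_def sum.reindex)
    ultimately have "x $ (inv \<phi> (\<phi> k)) = 0" for k
      using basis independentD[of "range \<phi>" "range \<phi>" "\<lambda>b. x $ (inv \<phi> b)" "\<phi> k"]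
      by (simp add: indexed_basis_def)
    then show "x = 0" using basis by (simp add: indexed_basis_def vec_eq_iff)
  qed
  then show ?thesis
    by (auto simp: invertible_left_inverse matrix_left_invertible_ker)
qed

section \<open>Affine dependence on the parameter\<close>

lemma form_matrix_param:
  "\<theta>\<^sub>1 *\<^sub>R form_matrix a\<^sub>1 \<phi> + \<theta>\<^sub>2 *\<^sub>R form_matrix a\<^sub>2 \<phi>
    = form_matrix (\<lambda>v w. \<theta>\<^sub>1 * a\<^sub>1 v w + \<theta>\<^sub>2 * a\<^sub>2 v w) \<phi>"
  by (simp add: form_matrix_def vec_eq_iff)

lemma bilinear_lincomb:
  fixes a\<^sub>1 a\<^sub>2 :: "'h::real_vector \<Rightarrow> 'h \<Rightarrow> real"
  assumes "bilinear a\<^sub>1" "bilinear a\<^sub>2"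
  shows "bilinear (\<lambda>v w. c\<^sub>1 * a\<^sub>1 v w + c\<^sub>2 * a\<^sub>2 v w)"
  using assms by (simp add: bilinear_def linear_iff algebra_simps)

text \<open>Cramer's rule for the two equations that match the coefficients of
  \<open>A\<^sub>1\<close> and \<open>A\<^sub>2\<close>; the assumption says that their determinant
  is nonzero.\<close>

lemma param_matrix_lincomb:
  assumes "\<theta>\<^sub>1 \<mu>\<^sub>0 * \<theta>\<^sub>2 \<mu>\<^sub>1 - \<theta>\<^sub>2 \<mu>\<^sub>0 * \<theta>\<^sub>1 \<mu>\<^sub>1 \<noteq> 0"
  obtains s t where "param_matrix \<theta>\<^sub>1 \<theta>\<^sub>2 A\<^sub>1 A\<^sub>2 \<mu>
    = s *\<^sub>R param_matrix \<theta>\<^sub>1 \<theta>\<^sub>2 A\<^sub>1 A\<^sub>2 \<mu>\<^sub>0 + t *\<^sub>R param_matrix \<theta>\<^sub>1 \<theta>\<^sub>2 A\<^sub>1 A\<^sub>2 \<mu>\<^sub>1"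
proof -
  define d where "d = \<theta>\<^sub>1 \<mu>\<^sub>0 * \<theta>\<^sub>2 \<mu>\<^sub>1 - \<theta>\<^sub>2 \<mu>\<^sub>0 * \<theta>\<^sub>1 \<mu>\<^sub>1"
  define s where "s = (\<theta>\<^sub>1 \<mu> * \<theta>\<^sub>2 \<mu>\<^sub>1 - \<theta>\<^sub>2 \<mu> * \<theta>\<^sub>1 \<mu>\<^sub>1) / d"
  define t where "t = (\<theta>\<^sub>1 \<mu>\<^sub>0 * \<theta>\<^sub>2 \<mu> - \<theta>\<^sub>2 \<mu>\<^sub>0 * \<theta>\<^sub>1 \<mu>) / d"
  have "d \<noteq> 0" using assms by (simp add: d_def)
  have "s * \<theta>\<^sub>1 \<mu>\<^sub>0 + t * \<theta>\<^sub>1 \<mu>\<^sub>1 = \<theta>\<^sub>1 \<mu> * d / d" "s * \<theta>\<^sub>2 \<mu>\<^sub>0 + t * \<theta>\<^sub>2 \<mu>\<^sub>1 = \<theta>\<^sub>2 \<mu> * d / d"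
    unfolding s_def t_def by (simp_all add: d_def algebra_simps flip: add_divide_distrib)
  then have "\<theta>\<^sub>1 \<mu> = s * \<theta>\<^sub>1 \<mu>\<^sub>0 + t * \<theta>\<^sub>1 \<mu>\<^sub>1" "\<theta>\<^sub>2 \<mu> = s * \<theta>\<^sub>2 \<mu>\<^sub>0 + t * \<theta>\<^sub>2 \<mu>\<^sub>1"
    using \<open>d \<noteq> 0\<close> by simp_all
  then show ?thesis
    by (intro that[of s t]) (simp add: param_matrix_def algebra_simps)
qed

text \<open>The sign condition on \<gamma> matters because the bound sees only its square: for
  \<open>B ** A \<mu> = diag(1,-1)\<close> and \<open>M = I\<close>, \<gamma> is -1 and the factor
  is 0, yet \<open>m = 1\<close> and \<open>B *v f = (1,1)\<close> allow no reduction of the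
  residual.\<close>

theorem theorem3p1:
  fixes \<phi> :: "'n::finite \<Rightarrow> 'h::real_inner"
    and a\<^sub>1 a\<^sub>2 :: "'h \<Rightarrow> 'h \<Rightarrow> real"
    and F :: "'h \<Rightarrow> real"
    and P :: "(real^'d) set"
    and \<theta>\<^sub>1 \<theta>\<^sub>2 :: "real^'d \<Rightarrow> real"
    and A\<^sub>1 A\<^sub>2 B M :: "real^'n^'n"
    and A :: "real^'d \<Rightarrow> real^'n^'n"
    and f u u_hat :: "real^'n"
    and \<mu>\<^sub>0 \<mu>\<^sub>1 \<mu> :: "real^'d"
    and m :: nat
    and z :: "nat \<Rightarrow> real^'n"
    and \<gamma> \<Gamma> :: real
  assumes "indexed_basis \<phi>"
    and "bilinear a\<^sub>1" and "bilinear a\<^sub>2" and "bounded_linear F"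
    and "A\<^sub>1 = form_matrix a\<^sub>1 \<phi>" and "A\<^sub>2 = form_matrix a\<^sub>2 \<phi>" and "f = load_vector F \<phi>"
    and "compact P"
    and "A = param_matrix \<theta>\<^sub>1 \<theta>\<^sub>2 A\<^sub>1 A\<^sub>2"
    and "\<And>\<nu>. \<nu> \<in> P \<Longrightarrow> well_posed (\<lambda>v w. \<theta>\<^sub>1 \<nu> * a\<^sub>1 v w + \<theta>\<^sub>2 \<nu> * a\<^sub>2 v w)"
    and "\<mu>\<^sub>0 \<in> P" and "\<mu>\<^sub>1 \<in> P" and "\<mu>\<^sub>0 \<noteq> \<mu>\<^sub>1"
    and "B = matrix_inv (A \<mu>\<^sub>0)"
    and "sym_pos_def M"
    and "0 < m"
    and "\<theta>\<^sub>1 \<mu>\<^sub>0 * \<theta>\<^sub>2 \<mu>\<^sub>1 - \<theta>\<^sub>2 \<mu>\<^sub>0 * \<theta>\<^sub>1 \<mu>\<^sub>1 \<noteq> 0"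
    and "\<mu> \<in> P"
    and "\<theta>\<^sub>1 \<mu>\<^sub>0 * \<theta>\<^sub>2 \<mu> - \<theta>\<^sub>2 \<mu>\<^sub>0 * \<theta>\<^sub>1 \<mu> \<noteq> 0"
    and "\<gamma> = coercivity_const M (B ** A \<mu>)" and "\<Gamma> = opnorm_wrt M (B ** A \<mu>)"
    and "A \<mu> *v u = f"
    and "rkbm_offline A f B \<mu>\<^sub>1 m z"
    and "rkbm_online A f B M m z \<mu> u_hat"
    and "0 \<le> \<gamma>"
    and "no_stagnation m z"
  shows "norm_wrt M ((B ** A \<mu>) *v (u - u_hat))
    \<le> (1 - \<gamma>\<^sup>2 / \<Gamma>\<^sup>2) powr (real m / 2) * norm_wrt M (B *v f)"
proof -
  define C where "C = B ** A \<mu>"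
  define D where "D = B ** A \<mu>\<^sub>1"
  define r where "r = B *v f"
  have "invertible (A \<mu>\<^sub>0)"
    using assms(1-6,9,11) assms(10)[OF assms(11)]
    by (simp add: param_matrix_def form_matrix_param invertible_form_matrix bilinear_lincomb)
  \<comment> \<open>\<open>matrix_inv\<close> is a Hilbert choice, so its inverse property needs the
    invertibility just shown.\<close>
  then have BA: "B ** A \<mu>\<^sub>0 = mat 1"
    using someI_ex[of "\<lambda>X. A \<mu>\<^sub>0 ** X = mat 1 \<and> X ** A \<mu>\<^sub>0 = mat 1"]
    by (simp add: assms(14) matrix_inv_def invertible_def)
  obtain s t where "A \<mu> = s *\<^sub>R A \<mu>\<^sub>0 + t *\<^sub>R A \<mu>\<^sub>1"
    using param_matrix_lincomb[where \<mu> = \<mu>] assms(9,17) by metis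
  then have "C = s *\<^sub>R mat 1 + t *\<^sub>R D"
    by (simp add: C_def D_def BA matrix_add_ldistrib matrix_scalar_ac flip: scalar_matrix_assoc)
  then have C: "C *v v = s *\<^sub>R v + t *\<^sub>R (D *v v)" for v
    by (simp add: matrix_vector_mult_add_rdistrib scaleR_matrix_vector_assoc[symmetric])
  obtain w where "\<And>j. j < m \<Longrightarrow> gmres_iterate D r 0 j (w j)"
      and "\<And>j. j < m \<Longrightarrow> z j = r - D *v w j"
    using assms(23) unfolding rkbm_offline_def D_def r_def
    by (auto simp: matrix_vector_mult_diff_distrib matrix_vector_mul_assoc)
  then have K: "reduced_space m z = krylov D r m"
    unfolding reduced_space_def using assms(26) by (intro span_gmres_residuals) auto
  define \<alpha> where "\<alpha> = \<gamma> / \<Gamma>\<^sup>2"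
  obtain v where v: "v \<in> reduced_space m z"
    and eq: "((\<lambda>x. x - \<alpha> *\<^sub>R (C *v x)) ^^ m) r = r - C *v v"
    using krylov_richardson[OF C, where r = r and j = m and \<alpha> = \<alpha>] unfolding K by blast
  \<comment> \<open>Since \<open>u\<close> solves the problem exactly, the quantity to bound is the
    residual that the online stage minimizes, and \<open>v\<close> is a competitor.\<close>
  have "C *v (u - u_hat) = r - C *v u_hat"
    by (simp add: C_def r_def matrix_vector_mult_diff_distrib assms(22)
        flip: matrix_vector_mul_assoc)
  then have "norm_wrt M (C *v (u - u_hat)) \<le> norm_wrt M (r - C *v v)"
    using assms(24) v by (simp add: rkbm_online_def C_def r_def)
  also have "\<dots> \<le> (1 - \<gamma>\<^sup>2 / \<Gamma>\<^sup>2) powr (real m / 2) * norm_wrt M r"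
    unfolding eq[symmetric] \<alpha>_def
    using richardson_contraction[OF assms(15), of C m r] assms(16,25)
    by (simp only: assms(20,21) C_def)
  finally show ?thesis by (simp add: C_def r_def)
qed

end
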